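(* Let $K$ be an arbitrary field, $m\geq 4$ and $\Gamma\in\mathbb{S}(m)$. 1. Suppose that $|\operatorname{ind}(\Gamma)|=1$, i.e. $\operatorname{ind}(\Gamma)=\{\nu_1\}$. Then the affine algebraic variety $\mathcal{A}(m,\Gamma)$ is isomorphic to the affine space $\mathbb{A}^{|C\Gamma(\nu_1)|}$. 2. Suppose that $s=|\operatorname{ind}(\Gamma)|\geq 2$ and $\operatorname{dec}(\Gamma)_{\geq 2}=\emptyset$. Then the affine algebraic variety $\mathcal{A}(m,\Gamma)$ is isomorphic to the affine space $\mathbb{A}^{|C\Gamma(\nu_1)|+\cdots+|C\Gamma(\nu_s)|}$, where $\operatorname{ind}(\Gamma)=\{\nu_1,\ldots,\nu_s\}$.
   Context: $\mathbb{S}(m)$ is the set consisting of the empty set and of all non-empty subsets $\Gamma\subseteq\{2,\ldots,m-2\}$ such that $\Gamma+\Gamma\subseteq\Gamma\cup[m,\infty)$. An element of $\Gamma$ is decomposable if it is a sum of two elements of $\Gamma$; $\operatorname{ind}(\Gamma)$ and $\operatorname{dec}(\Gamma)$ are the sets of indecomposable and decomposable elements. With $\operatorname{ind}(\Gamma)=\{\nu_1<\cdots<\nu_s\}$, $\operatorname{dec}(\Gamma)_{\geq 2}$ is the set of $\gamma\in\operatorname{dec}(\Gamma)$ for which there are at least two vectors $a\in\mathbb{N}^s$ with $\sum_ia_i\nu_i=\gamma$. $C\Gamma(\gamma):=\{\delta\mid\delta\notin\Gamma,\gamma<\delta\leq m-1\}$. $\mathcal{A}(m)$ is the set of all $K$-subalgebras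 $A$ of $K[x]$ such that $x^mK[x]\subset A$ and $x^{m-1}\notin A$. For $A\in\mathcal{A}(m)$, $\Gamma_A\in\mathbb{S}(m)$ is the set of integers $\gamma$ with $1\leq\gamma\leq m-1$ such that $A$ contains an element of the form $x^\gamma+\sum_{j>\gamma}\lambda_jx^j$. $\mathcal{A}(m,\Gamma):=\{A\in\mathcal{A}(m)\mid\Gamma_A=\Gamma\}$. The algebra $\overline{A}:=A/x^mK[x]\subseteq K[x]/x^mK[x]$ has a unique $K$-basis $\{1,f_\gamma\mid\gamma\in\Gamma\}$ (the canonical basis) with $f_\gamma=x^\gamma+\sum_{\delta\in C\Gamma(\gamma)}\lambda_{\gamma,\delta}x^\delta$, $\lambda_{\gamma,\delta}\in K$. Variety structure on $\mathcal{A}(m,\Gamma)$: the coefficients $\{\lambda_{\nu_i,j}\mid i=1,\ldots,s;\ j\in C\Gamma(\nu_i)\}$ of $f_{\nu_1},\ldots,f_{\nu_s}$ uniquely determine $A$; they are treated as regular functions (coordinates) on $\mathcal{A}(m,\Gamma)$, which is thereby viewed as a subset of the affine space of dimension $\sum_{i=1}^s|C\Gamma(\nu_i)|$. *)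

theory Defs
  imports "HOL-Library.FuncSet" "HOL-Computational_Algebra.Polynomial"
begin

section \<open>Affine algebraic varieties over a field\<close>

text \<open>
  Varieties are sets of \<open>K\<close>-points. Affine space carries coordinates indexed by an arbitrary finite
  set \<open>I\<close>; points are functions on \<open>I\<close> (extensional, so that equality of points is equality of
  coordinates).
\<close>

definition affine_space :: "'i set \<Rightarrow> ('i \<Rightarrow> 'k::field) set" where
  "affine_space I = I \<rightarrow>\<^sub>E UNIV"

inductive polynomial_fun :: "'i set \<Rightarrow> (('i \<Rightarrow> 'k::field) \<Rightarrow> 'k) \<Rightarrow> bool" for I where
  const: "polynomial_fun I (\<lambda>_. c)"
| coordinate: "i \<in> I \<Longrightarrow> polynomial_fun I (\<lambda>x. x i)"
| add: "polynomial_fun I p \<Longrightarrow> polynomial_fun I q \<Longrightarrow> polynomial_fun I (\<lambda>x. p x + q x)"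
| mult: "polynomial_fun I p \<Longrightarrow> polynomial_fun I q \<Longrightarrow> polynomial_fun I (\<lambda>x. p x * q x)"

definition algebraic_set :: "'i set \<Rightarrow> ('i \<Rightarrow> 'k::field) set \<Rightarrow> bool" where
  "algebraic_set I Z \<longleftrightarrow>
     (\<exists>P. (\<forall>p\<in>P. polynomial_fun I p) \<and> Z = {x \<in> affine_space I. \<forall>p\<in>P. p x = 0})"

text \<open>
  A set \<open>X\<close> whose elements need not be points of an affine space becomes an affine variety through
  a map \<open>c\<close> assigning to each element its coordinates, indexed by \<open>I\<close>: the coordinates must
  determine the element, and the coordinate vectors must form a Zariski closed set.
\<close>

definition affine_variety :: "'i set \<Rightarrow> ('a \<Rightarrow> 'i \<Rightarrow> 'k::field) \<Rightarrow> 'a set \<Rightarrow> bool" where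
  "affine_variety I c X \<longleftrightarrow> finite I \<and> inj_on c X \<and> algebraic_set I (c ` X)"

definition regular_map ::
  "'i set \<Rightarrow> ('a \<Rightarrow> 'i \<Rightarrow> 'k::field) \<Rightarrow> 'a set \<Rightarrow>
   'j set \<Rightarrow> ('b \<Rightarrow> 'j \<Rightarrow> 'k) \<Rightarrow> 'b set \<Rightarrow> ('a \<Rightarrow> 'b) \<Rightarrow> bool" where
  "regular_map I c X J d Y \<phi> \<longleftrightarrow>
     \<phi> \<in> X \<rightarrow> Y \<and> (\<forall>j\<in>J. \<exists>p. polynomial_fun I p \<and> (\<forall>x\<in>X. d (\<phi> x) j = p (c x)))"

definition isomorphic_varieties ::
  "'i set \<Rightarrow> ('a \<Rightarrow> 'i \<Rightarrow> 'k::field) \<Rightarrow> 'a set \<Rightarrow>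
   'j set \<Rightarrow> ('b \<Rightarrow> 'j \<Rightarrow> 'k) \<Rightarrow> 'b set \<Rightarrow> bool" where
  "isomorphic_varieties I c X J d Y \<longleftrightarrow>
     affine_variety I c X \<and> affine_variety J d Y \<and>
     (\<exists>\<phi> \<psi>. regular_map I c X J d Y \<phi> \<and> regular_map J d Y I c X \<psi> \<and>
        (\<forall>x\<in>X. \<psi> (\<phi> x) = x) \<and> (\<forall>y\<in>Y. \<phi> (\<psi> y) = y))"

section \<open>The combinatorics of \<open>\<S>(m)\<close>\<close>

definition SS :: "nat \<Rightarrow> nat set set" where
  "SS m = {{}} \<union> {\<Gamma>. \<Gamma> \<noteq> {} \<and> \<Gamma> \<subseteq> {2..m - 2} \<and>
                      {a + b | a b. a \<in> \<Gamma> \<and> b \<in> \<Gamma>} \<subseteq> \<Gamma> \<union> {m..}}"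

definition dec :: "nat set \<Rightarrow> nat set" where
  "dec \<Gamma> = {\<gamma>\<in>\<Gamma>. \<exists>a\<in>\<Gamma>. \<exists>b\<in>\<Gamma>. \<gamma> = a + b}"

definition ind :: "nat set \<Rightarrow> nat set" where
  "ind \<Gamma> = \<Gamma> - dec \<Gamma>"

text \<open>
  Vectors in \<open>\<nat>\<^sup>s\<close> are indexed by the elements \<open>\<nu>\<close> of \<open>ind \<Gamma>\<close> themselves rather
  than by their positions in increasing order.
\<close>

definition dec_ge2 :: "nat set \<Rightarrow> nat set" where
  "dec_ge2 \<Gamma> = {\<gamma> \<in> dec \<Gamma>. \<exists>a \<in> ind \<Gamma> \<rightarrow>\<^sub>E UNIV. \<exists>b \<in> ind \<Gamma> \<rightarrow>\<^sub>E UNIV.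
      a \<noteq> b \<and> (\<Sum>\<nu>\<in>ind \<Gamma>. a \<nu> * \<nu>) = \<gamma> \<and> (\<Sum>\<nu>\<in>ind \<Gamma>. b \<nu> * \<nu>) = \<gamma>}"

definition CG :: "nat \<Rightarrow> nat set \<Rightarrow> nat \<Rightarrow> nat set" where
  "CG m \<Gamma> \<gamma> = {\<delta>. \<delta> \<notin> \<Gamma> \<and> \<gamma> < \<delta> \<and> \<delta> \<le> m - 1}"

section \<open>Subalgebras of \<open>K[x]\<close> and the variety \<open>\<A>(m, \<Gamma>)\<close>\<close>

definition subalgebra :: "'k::field poly set \<Rightarrow> bool" where
  "subalgebra A \<longleftrightarrow> 1 \<in> A \<and> (\<forall>c. \<forall>p\<in>A. smult c p \<in> A) \<and>
     (\<forall>p\<in>A. \<forall>q\<in>A. p + q \<in> A) \<and> (\<forall>p\<in>A. \<forall>q\<in>A. p * q \<in> A)"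

definition AA :: "nat \<Rightarrow> 'k::field poly set set" where
  "AA m = {A. subalgebra A \<and> range (\<lambda>p. monom 1 m * p) \<subseteq> A \<and> monom 1 (m - 1) \<notin> A}"

definition Gam :: "nat \<Rightarrow> 'k::field poly set \<Rightarrow> nat set" where
  "Gam m A = {\<gamma>. 1 \<le> \<gamma> \<and> \<gamma> \<le> m - 1 \<and>
      (\<exists>p\<in>A. coeff p \<gamma> = 1 \<and> (\<forall>j<\<gamma>. coeff p j = 0))}"

definition AAG :: "nat \<Rightarrow> nat set \<Rightarrow> 'k::field poly set set" where
  "AAG m \<Gamma> = {A \<in> AA m. Gam m A = \<Gamma>}"

text \<open>
  A basis of \<open>A / x\<^sup>mK[x]\<close> is given by its representatives of degree less than \<open>m\<close>, which
  lie in \<open>A\<close> because \<open>x\<^sup>mK[x] \<subseteq> A\<close>; the basis element \<open>1\<close> gets index \<open>0\<close>. The last conjunct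
  states the basis property: every element of \<open>A\<close> is, modulo \<open>x\<^sup>m\<close>, a unique linear combination.
\<close>

definition is_canonical_basis :: "nat \<Rightarrow> 'k::field poly set \<Rightarrow> (nat \<Rightarrow> 'k poly) \<Rightarrow> bool" where
  "is_canonical_basis m A f \<longleftrightarrow>
     f \<in> extensional (insert 0 (Gam m A)) \<and> f 0 = 1 \<and>
     (\<forall>\<gamma>\<in>Gam m A. f \<gamma> \<in> A \<and>
        (\<exists>l. f \<gamma> = monom 1 \<gamma> + (\<Sum>\<delta>\<in>CG m (Gam m A) \<gamma>. monom (l \<delta>) \<delta>))) \<and>
     (\<forall>p\<in>A. \<exists>!c. c \<in> insert 0 (Gam m A) \<rightarrow>\<^sub>E UNIV \<and>
        monom 1 m dvd p - (\<Sum>\<gamma>\<in>insert 0 (Gam m A). smult (c \<gamma>) (f \<gamma>)))"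

definition canonical_basis :: "nat \<Rightarrow> 'k::field poly set \<Rightarrow> nat \<Rightarrow> 'k poly" where
  "canonical_basis m A = (THE f. is_canonical_basis m A f)"

definition coord_index :: "nat \<Rightarrow> nat set \<Rightarrow> (nat \<times> nat) set" where
  "coord_index m \<Gamma> = (SIGMA \<nu>:ind \<Gamma>. CG m \<Gamma> \<nu>)"

definition coords :: "nat \<Rightarrow> nat set \<Rightarrow> 'k::field poly set \<Rightarrow> nat \<times> nat \<Rightarrow> 'k" where
  "coords m \<Gamma> A = (\<lambda>(\<nu>, j)\<in>coord_index m \<Gamma>. coeff (canonical_basis m A \<nu>) j)"

end

theory Submission
  imports Defs
begin

text \<open>
  Both cases fall under \<open>dec_ge2 \<Gamma> = {}\<close>, and there the coordinate map from \<open>\<A>(m, \<Gamma>)\<close> to the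
  ambient affine space is bijective. It is injective because products of the \<open>f\<^sub>\<nu>\<close>, \<open>\<nu> \<in> ind \<Gamma>\<close>,
  realise every leading exponent \<open>\<gamma> \<in> \<Gamma>\<close> and so span \<open>A\<close> modulo \<open>x\<^sup>m\<close>. It is surjective because,
  for arbitrary coefficients, the span of \<open>1\<close> and the products \<open>g\<^sub>\<gamma> = \<Prod>\<^sub>\<nu> f\<^sub>\<nu>\<^bsup>a(\<nu>)\<^esup>\<close> with
  \<open>\<Sum>\<^sub>\<nu> a(\<nu>) \<nu> = \<gamma> \<in> \<Gamma>\<close> is closed under multiplication modulo \<open>x\<^sup>m\<close>: uniqueness of \<open>a\<close> gives
  \<open>g\<^sub>\<gamma> g\<^sub>\<delta> = g\<^bsub>\<gamma>+\<delta>\<^esub>\<close> when \<open>\<gamma> + \<delta> < m\<close>.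
\<close>

section \<open>Leading terms at the origin\<close>

text \<open>Leading means lowest exponent here: this is the x-adic order together with a normalised
  lowest coefficient, the notion underlying \<open>Gam\<close>.\<close>

definition leads :: "nat \<Rightarrow> 'k::field poly \<Rightarrow> bool" where
  "leads n p \<longleftrightarrow> coeff p n = 1 \<and> (\<forall>j<n. coeff p j = 0)"

text \<open>Splitting off \<open>monom 1 n\<close> reduces multiplicativity of leading terms to that
  of constant coefficients.\<close>

lemma leads_iff_monom_mult: "leads n p \<longleftrightarrow> (\<exists>q. p = monom 1 n * q \<and> coeff q 0 = 1)"
proof
  assume "leads n p"
  moreover from this obtain q where "p = monom 1 n * q"
    unfolding leads_def by (metis monom_1_dvd_iff' dvdE)
  ultimately show "\<exists>q. p = monom 1 n * q \<and> coeff q 0 = 1"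
    by (auto simp: leads_def coeff_monom_mult)
qed (auto simp: leads_def coeff_monom_mult)

lemma leads_0_1: "leads 0 1"
  by (simp add: leads_def)

lemma leads_mult: "leads a p \<Longrightarrow> leads b q \<Longrightarrow> leads (a + b) (p * q)"
proof -
  assume "leads a p" "leads b q"
  then obtain p' q' where "p = monom 1 a * p'" "coeff p' 0 = 1" "q = monom 1 b * q'" "coeff q' 0 = 1"
    unfolding leads_iff_monom_mult by blast
  then have "p * q = monom 1 (a + b) * (p' * q')" "coeff (p' * q') 0 = 1"
    by (simp_all add: coeff_mult_0 mult_ac mult_monom flip: mult.assoc)
  then show ?thesis
    unfolding leads_iff_monom_mult by blast
qed

lemma leads_power: "leads a p \<Longrightarrow> leads (n * a) (p ^ n)"
  by (induction n) (auto intro: leads_0_1 leads_mult)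

lemma leads_prod_power:
  "finite S \<Longrightarrow> (\<And>i. i \<in> S \<Longrightarrow> leads i (f i)) \<Longrightarrow> leads (\<Sum>i\<in>S. a i * i) (\<Prod>i\<in>S. f i ^ a i)"
  by (induction S rule: finite_induct) (auto intro: leads_0_1 leads_mult leads_power)

text \<open>The family is triangular: terms with \<open>s < k\<close> carry the scalar 0, and terms
  with \<open>s > k\<close> start only beyond exponent \<open>k\<close>.\<close>

lemma coeff_sum_leads:
  assumes "finite S" and "\<And>s. s \<in> S \<Longrightarrow> leads s (g s)" and "\<And>s. s \<in> S \<Longrightarrow> s < k \<Longrightarrow> c s = 0"
  shows "coeff (\<Sum>s\<in>S. smult (c s) (g s)) k = (if k \<in> S then c k else 0)"
proof -
  have "c s * coeff (g s) k = (if s = k then c k else 0)" if "s \<in> S" for s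
    using assms(2,3)[OF that] by (cases s k rule: linorder_cases) (auto simp: leads_def)
  then have "coeff (\<Sum>s\<in>S. smult (c s) (g s)) k = (\<Sum>s\<in>S. if s = k then c k else 0)"
    by (simp add: coeff_sum)
  then show ?thesis
    using assms(1) by simp
qed

text \<open>The triangular system is solved from the lowest exponent upwards. For indices below
  \<open>k\<close> this is linear independence modulo x^k.\<close>

lemma sum_leads_low_coeffs_zero:
  assumes "finite S" and "\<And>s. s \<in> S \<Longrightarrow> leads s (g s)"
    and "\<And>j. j < k \<Longrightarrow> coeff (\<Sum>s\<in>S. smult (c s) (g s)) j = 0"
  shows "s \<in> S \<Longrightarrow> s < k \<Longrightarrow> c s = 0"
proof (induction s rule: less_induct)
  case (less s)
  have "coeff (\<Sum>s\<in>S. smult (c s) (g s)) s = (if s \<in> S then c s else 0)"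
    by (rule coeff_sum_leads) (use assms less in auto)
  then show ?case
    using less assms(3) by simp
qed

section \<open>Canonical bases\<close>

lemma subalgebra_diff:
  assumes "subalgebra A" "p \<in> A" "q \<in> A"
  shows "p - q \<in> A"
proof -
  have "p + smult (-1) q \<in> A"
    using assms unfolding subalgebra_def by blast
  then show ?thesis by simp
qed

lemma subalgebra_sum:
  assumes "subalgebra A" "\<And>i. i \<in> S \<Longrightarrow> p i \<in> A"
  shows "sum p S \<in> A"
proof -
  have "0 \<in> A"
    using subalgebra_diff[OF assms(1), of 1 1] assms(1) by (simp add: subalgebra_def)
  then show ?thesis
    using assms by (induction S rule: infinite_finite_induct) (auto simp: subalgebra_def)
qed

lemma AA_subalgebra: "A \<in> AA m \<Longrightarrow> subalgebra A"
  by (simp add: AA_def)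

lemma AA_dvd: "A \<in> AA m \<Longrightarrow> monom 1 m dvd p \<Longrightarrow> p \<in> A"
  by (auto simp: AA_def dvd_def)

lemma Gam_iff: "\<gamma> \<in> Gam m A \<longleftrightarrow> 1 \<le> \<gamma> \<and> \<gamma> \<le> m - 1 \<and> (\<exists>p\<in>A. leads \<gamma> p)"
  by (auto simp: Gam_def leads_def)

lemma finite_Gam: "finite (Gam m A)"
  by (rule finite_subset[of _ "{..m}"]) (auto simp: Gam_def)

text \<open>Over a field a nonzero lowest coefficient can be scaled to 1.\<close>

lemma GamI:
  assumes "subalgebra A" "p \<in> A" "\<And>j. j < k \<Longrightarrow> coeff p j = 0" "coeff p k \<noteq> 0" "1 \<le> k" "k < m"
  shows "k \<in> Gam m A"
proof -
  have "smult (inverse (coeff p k)) p \<in> A"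
    using assms unfolding subalgebra_def by blast
  moreover have "leads k (smult (inverse (coeff p k)) p)"
    using assms by (simp add: leads_def)
  ultimately show ?thesis
    using assms by (auto simp: Gam_iff)
qed

section \<open>Expansions modulo x^m along leading exponents\<close>

lemma leading_expansion:
  assumes A: "A \<in> AA m" and f: "\<And>\<gamma>. \<gamma> \<in> insert 0 (Gam m A) \<Longrightarrow> f \<gamma> \<in> A \<and> leads \<gamma> (f \<gamma>)"
    and "p \<in> A"
  shows "\<exists>c. monom 1 m dvd p - (\<Sum>\<gamma>\<in>insert 0 (Gam m A). smult (c \<gamma>) (f \<gamma>))"
proof -
  let ?S = "insert 0 (Gam m A)"
  have "\<exists>c. monom 1 m dvd p - (\<Sum>\<gamma>\<in>?S. smult (c \<gamma>) (f \<gamma>))"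
    if "k \<le> m" "p \<in> A" "\<forall>j<k. coeff p j = 0" for k p
    using that
  \<comment> \<open>The induction descends from \<open>k = m\<close>, where \<open>p\<close> is a
    multiple of x^m and all scalars are 0. Below that, a multiple of \<open>f k\<close> removes the
    coefficient of \<open>p\<close> at \<open>k\<close>.\<close>
  proof (induction k arbitrary: p rule: inc_induct)
    case base
    then have "monom 1 m dvd p - (\<Sum>\<gamma>\<in>?S. smult 0 (f \<gamma>))"
      by (simp add: monom_1_dvd_iff')
    then show ?case by (rule exI[of _ "\<lambda>_. 0"])
  next
    case (step k)
    show ?case
    proof (cases "coeff p k = 0")
      case True
      then show ?thesis
        using step by (auto simp: less_Suc_eq)
    next
      case False
      \<comment> \<open>\<open>GamI\<close> handles exponents from 1 on; exponent 0 is covered by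
        the inserted index.\<close>
      have k: "k \<in> ?S"
        using GamI[OF AA_subalgebra[OF A], of p k m] step False by (cases "k = 0") auto
      have "p - smult (coeff p k) (f k) \<in> A"
        using subalgebra_diff[OF AA_subalgebra[OF A]] step.prems f[OF k] AA_subalgebra[OF A]
        by (auto simp: subalgebra_def)
      moreover have "\<forall>j<Suc k. coeff (p - smult (coeff p k) (f k)) j = 0"
        using f[OF k] step.prems by (auto simp: leads_def less_Suc_eq)
      ultimately obtain c where
        c: "monom 1 m dvd p - smult (coeff p k) (f k) - (\<Sum>\<gamma>\<in>?S. smult (c \<gamma>) (f \<gamma>))"
        using step.IH by blast
      \<comment> \<open>The coefficient is added to \<open>c k\<close> because the induction
        hypothesis does not fix the value of \<open>c k\<close>.\<close>
      let ?c = "c(k := c k + coeff p k)"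
      have "(\<Sum>\<gamma>\<in>?S. smult (?c \<gamma>) (f \<gamma>)) =
          (\<Sum>\<gamma>\<in>?S. smult (c \<gamma>) (f \<gamma>) + (if \<gamma> = k then smult (coeff p k) (f k) else 0))"
        by (intro sum.cong) (auto simp: smult_add_left)
      also have "\<dots> = (\<Sum>\<gamma>\<in>?S. smult (c \<gamma>) (f \<gamma>)) + smult (coeff p k) (f k)"
        using k finite_Gam[of m A] by (subst sum.distrib) (simp only: sum.delta finite_insert if_True)
      finally have "monom 1 m dvd p - (\<Sum>\<gamma>\<in>?S. smult (?c \<gamma>) (f \<gamma>))"
        using c by (simp only: diff_diff_eq add.commute)
      then show ?thesis by blast
    qed
  qed
  from this[of 0 p] \<open>p \<in> A\<close> show ?thesis by simp
qed

text \<open>The difference of two expansions of \<open>p\<close> is divisible by x^m and all its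
  indices lie below \<open>m\<close>, so triangularity makes every scalar vanish. Extensionality
  then gives equality of the scalar functions.\<close>

lemma leading_expansion_unique:
  assumes A: "A \<in> AA m" and "m > 0"
    and f: "\<And>\<gamma>. \<gamma> \<in> insert 0 (Gam m A) \<Longrightarrow> f \<gamma> \<in> A \<and> leads \<gamma> (f \<gamma>)" and "p \<in> A"
  shows "\<exists>!c. c \<in> insert 0 (Gam m A) \<rightarrow>\<^sub>E UNIV \<and>
        monom 1 m dvd p - (\<Sum>\<gamma>\<in>insert 0 (Gam m A). smult (c \<gamma>) (f \<gamma>))"
proof (rule ex_ex1I)
  let ?S = "insert 0 (Gam m A)"
  obtain c where c: "monom 1 m dvd p - (\<Sum>\<gamma>\<in>?S. smult (c \<gamma>) (f \<gamma>))"
    using leading_expansion[OF A f \<open>p \<in> A\<close>] by blast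
  have "(\<Sum>\<gamma>\<in>?S. smult (restrict c ?S \<gamma>) (f \<gamma>)) = (\<Sum>\<gamma>\<in>?S. smult (c \<gamma>) (f \<gamma>))"
    by (rule sum.cong) (simp_all only: restrict_apply if_True)
  with c have "monom 1 m dvd p - (\<Sum>\<gamma>\<in>?S. smult (restrict c ?S \<gamma>) (f \<gamma>))"
    by (simp only:)
  then show "\<exists>c. c \<in> ?S \<rightarrow>\<^sub>E UNIV \<and> monom 1 m dvd p - (\<Sum>\<gamma>\<in>?S. smult (c \<gamma>) (f \<gamma>))"
    by (intro exI[of _ "restrict c ?S"] conjI restrict_PiE_iff[THEN iffD2] ballI UNIV_I)
next
  let ?S = "insert 0 (Gam m A)"
  fix c d
  assume c: "c \<in> ?S \<rightarrow>\<^sub>E UNIV \<and> monom 1 m dvd p - (\<Sum>\<gamma>\<in>?S. smult (c \<gamma>) (f \<gamma>))"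
    and d: "d \<in> ?S \<rightarrow>\<^sub>E UNIV \<and> monom 1 m dvd p - (\<Sum>\<gamma>\<in>?S. smult (d \<gamma>) (f \<gamma>))"
  have diff_rev: "v - u = (p - u) - (p - v)" for u v
    by simp
  have "(\<Sum>\<gamma>\<in>?S. smult (d \<gamma> - c \<gamma>) (f \<gamma>)) =
      (p - (\<Sum>\<gamma>\<in>?S. smult (c \<gamma>) (f \<gamma>))) - (p - (\<Sum>\<gamma>\<in>?S. smult (d \<gamma>) (f \<gamma>)))"
    unfolding smult_diff_left sum_subtractf by (rule diff_rev)
  then have dvd: "monom 1 m dvd (\<Sum>\<gamma>\<in>?S. smult (d \<gamma> - c \<gamma>) (f \<gamma>))"
    using dvd_diff[OF conjunct2[OF c] conjunct2[OF d]] by (simp only:)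
  have "d \<gamma> - c \<gamma> = 0" if \<gamma>: "\<gamma> \<in> ?S" for \<gamma>
  proof (rule sum_leads_low_coeffs_zero[where S = ?S and g = f and k = m])
    show "coeff (\<Sum>\<gamma>\<in>?S. smult (d \<gamma> - c \<gamma>) (f \<gamma>)) j = 0" if "j < m" for j
      using dvd[unfolded monom_1_dvd_iff'] that by (elim allE impE)
    show "\<gamma> < m"
      using \<gamma> \<open>m > 0\<close> by (auto simp: Gam_def)
    show "leads s (f s)" if "s \<in> ?S" for s
      using f[OF that] by (rule conjunct2)
  qed (use \<gamma> finite_Gam in simp_all)
  then show "c = d"
    using c d by (intro PiE_ext[of c ?S "\<lambda>_. UNIV" d]) simp_all
qed

text \<open>An element of \<open>A\<close> is expanded along leading elements that also lie in
  \<open>B\<close>; the remainder is divisible by x^m and therefore lies in \<open>B\<close> as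
  well.\<close>

lemma leading_generators_subset:
  assumes A: "A \<in> AA m" and B: "B \<in> AA m"
    and "\<And>\<gamma>. \<gamma> \<in> Gam m A \<Longrightarrow> \<exists>p \<in> A \<inter> B. leads \<gamma> p"
  shows "A \<subseteq> B"
proof
  fix p assume "p \<in> A"
  let ?S = "insert 0 (Gam m A)"
  have "1 \<in> A \<inter> B"
    using AA_subalgebra[OF A] AA_subalgebra[OF B] by (auto simp: subalgebra_def)
  then have "\<forall>\<gamma>\<in>?S. \<exists>p. p \<in> A \<inter> B \<and> leads \<gamma> p"
    using assms(3) leads_0_1 by blast
  then obtain f where f: "\<And>\<gamma>. \<gamma> \<in> ?S \<Longrightarrow> f \<gamma> \<in> A \<inter> B \<and> leads \<gamma> (f \<gamma>)"
    by metis
  obtain c where c: "monom 1 m dvd p - (\<Sum>\<gamma>\<in>?S. smult (c \<gamma>) (f \<gamma>))"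
    using leading_expansion[OF A _ \<open>p \<in> A\<close>, of f] f by blast
  have "(\<Sum>\<gamma>\<in>?S. smult (c \<gamma>) (f \<gamma>)) \<in> B"
    using AA_subalgebra[OF B] f by (intro subalgebra_sum) (auto simp: subalgebra_def)
  with AA_dvd[OF B c] AA_subalgebra[OF B]
  have "(p - (\<Sum>\<gamma>\<in>?S. smult (c \<gamma>) (f \<gamma>))) + (\<Sum>\<gamma>\<in>?S. smult (c \<gamma>) (f \<gamma>)) \<in> B"
    unfolding subalgebra_def by blast
  then show "p \<in> B" by simp
qed

section \<open>Canonical forms and the canonical basis\<close>

text \<open>Coefficientwise reading of the shape demanded in \<open>is_canonical_basis\<close>;
  \<open>canonical_form_iff\<close> translates between the two.\<close>

definition canonical_form :: "nat \<Rightarrow> nat set \<Rightarrow> nat \<Rightarrow> 'k::field poly \<Rightarrow> bool" where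
  "canonical_form m \<Gamma> \<gamma> p \<longleftrightarrow> coeff p \<gamma> = 1 \<and> (\<forall>j. j \<noteq> \<gamma> \<longrightarrow> j \<notin> CG m \<Gamma> \<gamma> \<longrightarrow> coeff p j = 0)"

lemma finite_CG: "finite (CG m \<Gamma> \<gamma>)"
  by (rule finite_subset[of _ "{..m}"]) (auto simp: CG_def)

lemma canonical_form_leads: "canonical_form m \<Gamma> \<gamma> p \<Longrightarrow> leads \<gamma> p"
  by (auto simp: canonical_form_def leads_def CG_def)

lemma coeff_canonical_sum:
  "coeff (monom 1 \<gamma> + (\<Sum>\<delta>\<in>CG m \<Gamma> \<gamma>. monom (l \<delta>) \<delta>)) j =
    (if j = \<gamma> then 1 else if j \<in> CG m \<Gamma> \<gamma> then l j else (0::'k::field))"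
proof -
  have "coeff (\<Sum>\<delta>\<in>CG m \<Gamma> \<gamma>. monom (l \<delta>) \<delta>) j = (if j \<in> CG m \<Gamma> \<gamma> then l j else 0)"
    using finite_CG[of m \<Gamma> \<gamma>] by (simp add: coeff_sum)
  then show ?thesis
    by (auto simp: CG_def)
qed

lemma canonical_form_iff:
  "canonical_form m \<Gamma> \<gamma> p \<longleftrightarrow> (\<exists>l. p = monom 1 \<gamma> + (\<Sum>\<delta>\<in>CG m \<Gamma> \<gamma>. monom (l \<delta>) \<delta>))"
proof
  assume "canonical_form m \<Gamma> \<gamma> p"
  then have "p = monom 1 \<gamma> + (\<Sum>\<delta>\<in>CG m \<Gamma> \<gamma>. monom (coeff p \<delta>) \<delta>)"
    by (intro poly_eqI, subst coeff_canonical_sum) (auto simp: canonical_form_def)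
  then show "\<exists>l. p = monom 1 \<gamma> + (\<Sum>\<delta>\<in>CG m \<Gamma> \<gamma>. monom (l \<delta>) \<delta>)" by blast
next
  assume "\<exists>l. p = monom 1 \<gamma> + (\<Sum>\<delta>\<in>CG m \<Gamma> \<gamma>. monom (l \<delta>) \<delta>)"
  then show "canonical_form m \<Gamma> \<gamma> p"
    by (auto simp: canonical_form_def coeff_canonical_sum simp del: coeff_add)
qed

text \<open>The lowest exponent at which \<open>p\<close> and \<open>q\<close> differ would be a gap
  of \<open>Gam m A\<close> and, as the leading exponent of \<open>p - q\<close> in
  \<open>A\<close>, also an element of it.\<close>

lemma canonical_form_unique:
  assumes A: "A \<in> AA m" and p: "p \<in> A" "canonical_form m (Gam m A) \<gamma> p"
    and q: "q \<in> A" "canonical_form m (Gam m A) \<gamma> q"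
  shows "p = q"
proof (rule ccontr)
  assume "p \<noteq> q"
  then have ex: "\<exists>k. coeff (p - q) k \<noteq> 0"
    by (simp add: poly_eq_iff)
  define k where "k = (LEAST k. coeff (p - q) k \<noteq> 0)"
  have k: "coeff (p - q) k \<noteq> 0" "\<And>j. j < k \<Longrightarrow> coeff (p - q) j = 0"
    unfolding k_def using LeastI_ex[OF ex] not_less_Least by blast+
  then have "k \<in> CG m (Gam m A) \<gamma>"
    using p q unfolding canonical_form_def by (metis coeff_diff diff_self)
  moreover from this have "k \<in> Gam m A"
    using GamI[OF AA_subalgebra[OF A] subalgebra_diff[OF AA_subalgebra[OF A] p(1) q(1)] k(2,1)]
    by (auto simp: CG_def)
  ultimately show False
    by (simp add: CG_def)
qed

text \<open>Starting from any element of \<open>A\<close> that leads at \<gamma>, the coefficients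
  at larger elements of \<open>Gam m A\<close> are cleared in increasing order; the result is then
  truncated at x^m.\<close>

lemma canonical_form_exists:
  assumes A: "A \<in> AA m" and \<gamma>: "\<gamma> \<in> Gam m A"
  shows "\<exists>p\<in>A. canonical_form m (Gam m A) \<gamma> p"
proof -
  have "\<exists>r\<in>A. leads \<gamma> r \<and> (\<forall>j\<in>Gam m A. \<gamma> < j \<and> j < k \<longrightarrow> coeff r j = 0)" for k
  proof (induction k)
    case 0
    then show ?case
      using \<gamma> by (auto simp: Gam_iff)
  next
    case (Suc k)
    then obtain r where r: "r \<in> A" "leads \<gamma> r" "\<forall>j\<in>Gam m A. \<gamma> < j \<and> j < k \<longrightarrow> coeff r j = 0"
      by blast
    show ?case
    proof (cases "k \<in> Gam m A \<and> \<gamma> < k")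
      case True
      then obtain q where q: "q \<in> A" "leads k q"
        by (auto simp: Gam_iff)
      \<comment> \<open>Since \<open>q\<close> leads at \<open>k\<close>, the subtraction clears the
        coefficient at \<open>k\<close> and changes nothing below it, so earlier coefficients stay
        cleared.\<close>
      have "r - smult (coeff r k) q \<in> A"
        using subalgebra_diff[OF AA_subalgebra[OF A]] q r AA_subalgebra[OF A]
        by (auto simp: subalgebra_def)
      moreover have "leads \<gamma> (r - smult (coeff r k) q)"
        using r q True by (simp add: leads_def)
      moreover have "\<forall>j\<in>Gam m A. \<gamma> < j \<and> j < Suc k \<longrightarrow> coeff (r - smult (coeff r k) q) j = 0"
        using r q by (auto simp: leads_def less_Suc_eq)
      ultimately show ?thesis by blast
    next
      case False
      then show ?thesis
        using r by (auto simp: less_Suc_eq)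
    qed
  qed
  then obtain r where r: "r \<in> A" "leads \<gamma> r" "\<forall>j\<in>Gam m A. \<gamma> < j \<and> j < m \<longrightarrow> coeff r j = 0"
    by blast
  \<comment> \<open>The part cut off is a multiple of x^m, hence an element of
    \<open>A\<close>.\<close>
  have "monom 1 m dvd r - poly_cutoff m r"
    by (simp add: monom_1_dvd_iff' coeff_poly_cutoff)
  from subalgebra_diff[OF AA_subalgebra[OF A] r(1) AA_dvd[OF A this]]
  have "poly_cutoff m r \<in> A" by simp
  moreover have "canonical_form m (Gam m A) \<gamma> (poly_cutoff m r)"
    unfolding canonical_form_def
  proof (intro conjI allI impI)
    show "coeff (poly_cutoff m r) \<gamma> = 1"
      using r \<gamma> by (auto simp: coeff_poly_cutoff leads_def Gam_def)
    show "coeff (poly_cutoff m r) j = 0" if "j \<noteq> \<gamma>" "j \<notin> CG m (Gam m A) \<gamma>" for j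
      using that r by (cases "j < \<gamma>") (auto simp: coeff_poly_cutoff leads_def CG_def)
  qed
  ultimately show ?thesis by blast
qed

text \<open>Canonical forms have the right leading terms, so \<open>leading_expansion_unique\<close>
  yields the expansion clause of the definition.\<close>

lemma is_canonical_basis_iff:
  assumes A: "A \<in> AA m" and "m > 0"
  shows "is_canonical_basis m A f \<longleftrightarrow> f \<in> extensional (insert 0 (Gam m A)) \<and> f 0 = 1 \<and>
     (\<forall>\<gamma>\<in>Gam m A. f \<gamma> \<in> A \<and> canonical_form m (Gam m A) \<gamma> (f \<gamma>))" (is "_ \<longleftrightarrow> ?R")
proof -
  let ?S = "insert 0 (Gam m A)"
  let ?E = "\<forall>p\<in>A. \<exists>!c. c \<in> ?S \<rightarrow>\<^sub>E UNIV \<and>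
      monom 1 m dvd p - (\<Sum>\<gamma>\<in>?S. smult (c \<gamma>) (f \<gamma>))"
  have eq: "is_canonical_basis m A f \<longleftrightarrow> ?R \<and> ?E"
    unfolding is_canonical_basis_def canonical_form_iff by (simp only: conj_assoc)
  have E: ?E if R: ?R
  proof -
    have "1 \<in> A"
      using AA_subalgebra[OF A] by (simp add: subalgebra_def)
    then have lead: "f \<gamma> \<in> A \<and> leads \<gamma> (f \<gamma>)" if "\<gamma> \<in> ?S" for \<gamma>
      using R that leads_0_1 canonical_form_leads[of m "Gam m A" \<gamma> "f \<gamma>"] by auto
    show ?E
      by (rule ballI, rule leading_expansion_unique[OF assms lead])
  qed
  show ?thesis
    unfolding eq by (rule iffI, erule conjunct1, rule conjI, assumption, rule E)
qed

text \<open>Existence and uniqueness together give the definite description in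
  \<open>canonical_basis\<close> its meaning.\<close>

lemma is_canonical_basis_canonical_basis:
  assumes A: "A \<in> AA m" and "m > 0"
  shows "is_canonical_basis m A (canonical_basis m A)"
proof -
  let ?\<Gamma> = "Gam m A"
  have "\<exists>f. is_canonical_basis m A f"
  proof -
    have "\<forall>\<gamma>\<in>?\<Gamma>. \<exists>p. p \<in> A \<and> canonical_form m ?\<Gamma> \<gamma> p"
      using canonical_form_exists[OF A] by blast
    from bchoice[OF this]
    obtain f where f: "\<And>\<gamma>. \<gamma> \<in> ?\<Gamma> \<Longrightarrow> f \<gamma> \<in> A \<and> canonical_form m ?\<Gamma> \<gamma> (f \<gamma>)"
      by blast
    \<comment> \<open>Restriction supplies extensionality, and the update at 0 overwrites no chosen
      value since 0 is not in \<open>Gam m A\<close>.\<close>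
    have "is_canonical_basis m A ((restrict f ?\<Gamma>)(0 := 1))"
      unfolding is_canonical_basis_iff[OF assms]
    proof (intro conjI ballI)
      show "(restrict f ?\<Gamma>)(0 := 1) \<in> extensional (insert 0 ?\<Gamma>)"
        by (simp add: extensional_def)
      fix \<gamma> assume \<gamma>: "\<gamma> \<in> ?\<Gamma>"
      then have "\<gamma> \<noteq> 0"
        by (simp add: Gam_iff)
      then show "((restrict f ?\<Gamma>)(0 := 1)) \<gamma> \<in> A"
        "canonical_form m ?\<Gamma> \<gamma> (((restrict f ?\<Gamma>)(0 := 1)) \<gamma>)"
        using f[OF \<gamma>] \<gamma> by simp_all
    qed simp
    then show ?thesis by blast
  qed
  moreover have "f = g" if f: "is_canonical_basis m A f" and g: "is_canonical_basis m A g" for f g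
  proof (rule extensionalityI)
    note fg = f[unfolded is_canonical_basis_iff[OF assms]] g[unfolded is_canonical_basis_iff[OF assms]]
    show "f \<in> extensional (insert 0 ?\<Gamma>)" "g \<in> extensional (insert 0 ?\<Gamma>)"
      using fg by simp_all
    show "f \<gamma> = g \<gamma>" if "\<gamma> \<in> insert 0 ?\<Gamma>" for \<gamma>
    proof (cases "\<gamma> = 0")
      case False
      with that have "\<gamma> \<in> ?\<Gamma>" by blast
      then have "f \<gamma> \<in> A" "canonical_form m ?\<Gamma> \<gamma> (f \<gamma>)" "g \<gamma> \<in> A" "canonical_form m ?\<Gamma> \<gamma> (g \<gamma>)"
        using fg by simp_all
      then show ?thesis
        by (rule canonical_form_unique[OF A])
    qed (use fg in simp)
  qed
  ultimately have "\<exists>!f. is_canonical_basis m A f"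
    by (rule ex_ex1I)
  then show ?thesis
    unfolding canonical_basis_def by (rule theI')
qed

lemma canonical_basis_props:
  assumes "A \<in> AA m" "m > 0" "\<gamma> \<in> Gam m A"
  shows "canonical_basis m A \<gamma> \<in> A" "canonical_form m (Gam m A) \<gamma> (canonical_basis m A \<gamma>)"
  using is_canonical_basis_canonical_basis[OF assms(1,2), unfolded is_canonical_basis_iff[OF assms(1,2)]]
    assms(3) by simp_all

text \<open>This serves to read off the coordinates of an algebra built from prescribed
  generators.\<close>

lemma canonical_basis_eq:
  assumes "A \<in> AA m" "m > 0" "\<gamma> \<in> Gam m A" "p \<in> A" "canonical_form m (Gam m A) \<gamma> p"
  shows "canonical_basis m A \<gamma> = p"
  using canonical_form_unique[OF assms(1) canonical_basis_props[OF assms(1-3)] assms(4,5)] .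

section \<open>The coordinate map\<close>

lemma SS_D:
  assumes "\<Gamma> \<in> SS m"
  shows "\<Gamma> \<subseteq> {2..m - 2}" "a \<in> \<Gamma> \<Longrightarrow> b \<in> \<Gamma> \<Longrightarrow> a + b \<in> \<Gamma> \<or> m \<le> a + b" "finite \<Gamma>"
  using assms by (auto simp: SS_def intro: finite_subset[of _ "{2..m - 2}"])

lemma ind_subset: "ind \<Gamma> \<subseteq> \<Gamma>"
  by (auto simp: ind_def)

text \<open>Since 0 \<notin> \<Gamma>, both summands of a decomposable element are strictly smaller
  than it, so strong induction ends at indecomposable elements.\<close>

lemma ind_induct [consumes 2, case_names ind add]:
  assumes "0 \<notin> \<Gamma>" and "\<gamma> \<in> \<Gamma>"
    and "\<And>\<nu>. \<nu> \<in> ind \<Gamma> \<Longrightarrow> P \<nu>"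
    and "\<And>a b. a \<in> \<Gamma> \<Longrightarrow> b \<in> \<Gamma> \<Longrightarrow> a + b \<in> \<Gamma> \<Longrightarrow> P a \<Longrightarrow> P b \<Longrightarrow> P (a + b)"
  shows "P \<gamma>"
  using assms(2)
proof (induction \<gamma> rule: less_induct)
  case (less \<gamma>)
  show ?case
  proof (cases "\<gamma> \<in> ind \<Gamma>")
    case False
    with less.prems obtain a b where ab: "a \<in> \<Gamma>" "b \<in> \<Gamma>" "\<gamma> = a + b"
      by (auto simp: ind_def dec_def)
    moreover from ab have "a \<noteq> 0" "b \<noteq> 0"
      using assms(1) by metis+
    ultimately have "a < \<gamma>" "b < \<gamma>"
      by simp_all
    then show ?thesis
      using assms(4) less ab by blast
  qed (rule assms(3))
qed

lemma coords_inj: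
  fixes \<Gamma> :: "nat set"
  assumes \<Gamma>: "0 \<notin> \<Gamma>" and "m > 0"
  shows "inj_on (coords m \<Gamma>) (AAG m \<Gamma> :: 'k::field poly set set)"
proof -
  have "A \<subseteq> B"
    if AB: "A \<in> AAG m \<Gamma>" "B \<in> AAG m \<Gamma>" "coords m \<Gamma> A = coords m \<Gamma> B" for A B :: "'k poly set"
  proof -
    have A: "A \<in> AA m" "Gam m A = \<Gamma>" and B: "B \<in> AA m" "Gam m B = \<Gamma>"
      using AB by (auto simp: AAG_def)
    have eq: "canonical_basis m A \<nu> = canonical_basis m B \<nu>" if "\<nu> \<in> ind \<Gamma>" for \<nu>
    proof (rule poly_eqI)
      fix j
      have \<nu>: "\<nu> \<in> \<Gamma>"
        using that ind_subset by blast
      show "coeff (canonical_basis m A \<nu>) j = coeff (canonical_basis m B \<nu>) j"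
      \<comment> \<open>Coefficients at gaps above \<nu> are coordinates; all others are fixed by
        the canonical form.\<close>
      proof (cases "j \<in> CG m \<Gamma> \<nu>")
        case True
        then have "(\<nu>, j) \<in> coord_index m \<Gamma>"
          using that by (simp add: coord_index_def)
        then show ?thesis
          using fun_cong[OF AB(3), of "(\<nu>, j)"] by (simp add: coords_def)
      next
        case False
        then show ?thesis
          using canonical_basis_props(2)[OF A(1) \<open>m > 0\<close>, of \<nu>]
            canonical_basis_props(2)[OF B(1) \<open>m > 0\<close>, of \<nu>] A(2) B(2) \<nu>
          by (cases "j = \<nu>") (auto simp: canonical_form_def)
      qed
    qed
    \<comment> \<open>The shared basis elements settle indecomposable exponents, and their products
      stay in both algebras.\<close>
    have "\<exists>p \<in> A \<inter> B. leads \<gamma> p" if "\<gamma> \<in> \<Gamma>" for \<gamma>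
      using \<Gamma> that
    proof (induction rule: ind_induct)
      case (ind \<nu>)
      then have "\<nu> \<in> \<Gamma>"
        using ind_subset by blast
      then show ?case
        using canonical_basis_props[OF A(1) \<open>m > 0\<close>, of \<nu>]
          canonical_basis_props[OF B(1) \<open>m > 0\<close>, of \<nu>] A(2) B(2) eq[OF ind] canonical_form_leads
        by (intro bexI[of _ "canonical_basis m A \<nu>"]) auto
    next
      case (add a b)
      then show ?case
        using AA_subalgebra[OF A(1)] AA_subalgebra[OF B(1)] leads_mult
        unfolding subalgebra_def by (metis IntE IntI)
    qed
    then show ?thesis
      using leading_generators_subset[OF A(1) B(1)] A(2) by blast
  qed
  then show ?thesis
    by (metis inj_onI subset_antisym)
qed

section \<open>Spans modulo x^m as subalgebras\<close>

text \<open>For finite \<open>S\<close> this is the preimage in K[x] of the linear span of the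
  classes of \<open>g s\<close> modulo x^m, so it contains all multiples of x^m.\<close>

definition truncated_span :: "nat \<Rightarrow> nat set \<Rightarrow> (nat \<Rightarrow> 'k::field poly) \<Rightarrow> 'k poly set" where
  "truncated_span m S g = {p. \<exists>c. monom 1 m dvd p - (\<Sum>s\<in>S. smult (c s) (g s))}"

lemma truncated_span_add:
  assumes "p \<in> truncated_span m S g" "q \<in> truncated_span m S g"
  shows "p + q \<in> truncated_span m S g"
proof -
  obtain c d where "monom 1 m dvd p - (\<Sum>s\<in>S. smult (c s) (g s))"
    "monom 1 m dvd q - (\<Sum>s\<in>S. smult (d s) (g s))"
    using assms by (auto simp: truncated_span_def)
  from dvd_add[OF this] have "monom 1 m dvd p + q - (\<Sum>s\<in>S. smult (c s + d s) (g s))"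
    by (simp add: smult_add_left sum.distrib algebra_simps)
  then show ?thesis
    unfolding truncated_span_def by (intro CollectI exI)
qed

lemma truncated_span_smult:
  assumes "p \<in> truncated_span m S g"
  shows "smult a p \<in> truncated_span m S g"
proof -
  obtain c where "monom 1 m dvd p - (\<Sum>s\<in>S. smult (c s) (g s))"
    using assms by (auto simp: truncated_span_def)
  then have "monom 1 m dvd smult a (p - (\<Sum>s\<in>S. smult (c s) (g s)))"
    by (rule dvd_smult)
  also have "\<dots> = smult a p - (\<Sum>s\<in>S. smult (a * c s) (g s))"
    by (intro poly_eqI) (simp add: coeff_sum sum_distrib_left algebra_simps)
  finally show ?thesis
    unfolding truncated_span_def by (intro CollectI exI)
qed

lemma truncated_span_dvd:
  assumes "monom 1 m dvd p"
  shows "p \<in> truncated_span m S g"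
  unfolding truncated_span_def using assms by (intro CollectI exI[of _ "\<lambda>_. 0"]) simp

lemma truncated_span_base:
  assumes "finite S" "s \<in> S"
  shows "g s \<in> truncated_span m S g"
proof -
  have "(\<Sum>t\<in>S. smult (if t = s then 1 else 0) (g t)) = (\<Sum>t\<in>S. if t = s then g s else 0)"
    by (intro sum.cong) auto
  then have "(\<Sum>t\<in>S. smult (if t = s then 1 else 0) (g t)) = g s"
    using assms by simp
  then show ?thesis
    unfolding truncated_span_def by (intro CollectI exI[of _ "\<lambda>t. if t = s then 1 else 0"]) simp
qed

lemma truncated_span_sum:
  "(\<And>i. i \<in> I \<Longrightarrow> p i \<in> truncated_span m S g) \<Longrightarrow> sum p I \<in> truncated_span m S g"
  by (induction I rule: infinite_finite_induct)
    (auto intro: truncated_span_add truncated_span_dvd)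

lemma truncated_span_mult:
  assumes "\<And>s t. s \<in> S \<Longrightarrow> t \<in> S \<Longrightarrow> g s * g t \<in> truncated_span m S g"
    and "p \<in> truncated_span m S g" "q \<in> truncated_span m S g"
  shows "p * q \<in> truncated_span m S g"
proof -
  obtain c d where c: "monom 1 m dvd p - (\<Sum>s\<in>S. smult (c s) (g s))"
    and d: "monom 1 m dvd q - (\<Sum>s\<in>S. smult (d s) (g s))"
    using assms by (auto simp: truncated_span_def)
  let ?p = "\<Sum>s\<in>S. smult (c s) (g s)" and ?q = "\<Sum>s\<in>S. smult (d s) (g s)"
  have "?p * ?q = (\<Sum>s\<in>S. \<Sum>t\<in>S. smult (c s * d t) (g s * g t))"
    by (simp add: sum_product mult.commute)
  also have "\<dots> \<in> truncated_span m S g"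
    using assms(1) by (intro truncated_span_sum truncated_span_smult) auto
  finally have "?p * ?q \<in> truncated_span m S g" .
  \<comment> \<open>These are the error terms made when \<open>p * q\<close> is replaced by
    \<open>?p * ?q\<close>; both are multiples of x^m.\<close>
  moreover have "(p - ?p) * q + ?p * (q - ?q) \<in> truncated_span m S g"
    using c d by (intro truncated_span_dvd dvd_add dvd_mult dvd_mult2)
  ultimately have "((p - ?p) * q + ?p * (q - ?q)) + ?p * ?q \<in> truncated_span m S g"
    by (rule truncated_span_add[rotated])
  then show ?thesis
    by (simp add: algebra_simps)
qed

text \<open>Below exponent \<open>m\<close> the coefficients of \<open>p\<close> agree with those of
  its combination, and by triangularity such a combination can start only at an index in
  \<open>S\<close>.\<close>

lemma truncated_span_order:
  assumes "finite S" "\<And>s. s \<in> S \<Longrightarrow> leads s (g s)" "p \<in> truncated_span m S g" "leads k p" "k < m"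
  shows "k \<in> S"
proof -
  obtain c where c: "monom 1 m dvd p - (\<Sum>s\<in>S. smult (c s) (g s))"
    using assms by (auto simp: truncated_span_def)
  then have eq: "coeff (\<Sum>s\<in>S. smult (c s) (g s)) j = coeff p j" if "j < m" for j
    using that by (simp add: monom_1_dvd_iff')
  have "c s = 0" if "s \<in> S" "s < k" for s
    using sum_leads_low_coeffs_zero[OF assms(1,2), of k c s] eq assms that
    by (simp add: leads_def)
  then have "coeff (\<Sum>s\<in>S. smult (c s) (g s)) k = (if k \<in> S then c k else 0)"
    using coeff_sum_leads[OF assms(1,2)] by blast
  then show ?thesis
    using eq[of k] assms by (auto simp: leads_def split: if_splits)
qed

text \<open>A product of generators stays in the span: either \<open>a + b\<close> lies in \<Gamma>
  and \<open>mult\<close> applies, or \<open>a + b\<close> is at least \<open>m\<close> and the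
  product vanishes modulo x^m. No further leading exponents arise, by
  \<open>truncated_span_order\<close>.\<close>

lemma truncated_span_AAG:
  assumes \<Gamma>: "\<Gamma> \<in> SS m" and "m \<ge> 2" and g0: "g 0 = 1"
    and g: "\<And>\<gamma>. \<gamma> \<in> \<Gamma> \<Longrightarrow> leads \<gamma> (g \<gamma>)"
    and mult: "\<And>a b. a \<in> \<Gamma> \<Longrightarrow> b \<in> \<Gamma> \<Longrightarrow> a + b \<in> \<Gamma> \<Longrightarrow> g a * g b = g (a + b)"
  shows "truncated_span m (insert 0 \<Gamma>) g \<in> AAG m \<Gamma>"
proof -
  let ?S = "insert 0 \<Gamma>" and ?A = "truncated_span m (insert 0 \<Gamma>) g"
  note [simp] = SS_D(3)[OF \<Gamma>]
  have gS: "leads s (g s)" if "s \<in> ?S" for s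
    using that g g0 leads_0_1 by auto
  have base: "g s \<in> ?A" if "s \<in> ?S" for s
    using that by (intro truncated_span_base) auto
  have "g a * g b \<in> ?A" if "a \<in> ?S" "b \<in> ?S" for a b
  proof (cases "a = 0 \<or> b = 0")
    case True
    then show ?thesis
      using base[of a] base[of b] that g0 by auto
  next
    case False
    with that have ab: "a \<in> \<Gamma>" "b \<in> \<Gamma>" by auto
    from SS_D(2)[OF \<Gamma> ab] show ?thesis
    proof
      assume "a + b \<in> \<Gamma>"
      then show ?thesis
        using mult[OF ab] base by auto
    next
      assume "m \<le> a + b"
      moreover have "leads (a + b) (g a * g b)"
        using ab g leads_mult by blast
      ultimately show ?thesis
        by (intro truncated_span_dvd) (auto simp: monom_1_dvd_iff' leads_def)
    qed
  qed
  then have "subalgebra ?A"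
    unfolding subalgebra_def using base[of 0] g0
    by (auto intro: truncated_span_mult truncated_span_smult truncated_span_add)
  moreover have "monom 1 (m - 1) \<notin> ?A"
  proof
    assume "monom 1 (m - 1) \<in> ?A"
    then have "m - 1 \<in> ?S"
      by (rule truncated_span_order[where g = g, rotated 2])
        (use gS \<open>m \<ge> 2\<close> in \<open>auto simp: leads_def\<close>)
    \<comment> \<open>\<open>m - 1\<close> exceeds every element of \<Gamma>, and
      \<open>m \<ge> 2\<close> separates it from the index 0.\<close>
    then show False
      using subsetD[OF SS_D(1)[OF \<Gamma>], of "m - 1"] \<open>m \<ge> 2\<close> by auto
  qed
  moreover have "range (\<lambda>p. monom 1 m * p) \<subseteq> ?A"
    by (auto intro: truncated_span_dvd)
  moreover have "Gam m ?A = \<Gamma>"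
  proof
    show "Gam m ?A \<subseteq> \<Gamma>"
    proof
      fix \<gamma> assume "\<gamma> \<in> Gam m ?A"
      then obtain p where "1 \<le> \<gamma>" "\<gamma> < m" "p \<in> ?A" "leads \<gamma> p"
        using \<open>m \<ge> 2\<close> by (auto simp: Gam_iff)
      then have "\<gamma> \<in> ?S"
        using truncated_span_order[of ?S g] gS by (metis SS_D(3)[OF \<Gamma>] finite_insert)
      then show "\<gamma> \<in> \<Gamma>"
        using \<open>1 \<le> \<gamma>\<close> by simp
    qed
    show "\<Gamma> \<subseteq> Gam m ?A"
      using SS_D(1)[OF \<Gamma>] base g by (fastforce simp: Gam_iff)
  qed
  ultimately show ?thesis
    by (simp add: AAG_def AA_def)
qed

section \<open>Surjectivity of the coordinates\<close>

text \<open>Unit vectors serve the indecomposable elements, and vectors are added where elements are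
  added.\<close>

lemma ind_combination_exists:
  assumes "0 \<notin> \<Gamma>" "finite \<Gamma>" "\<gamma> \<in> \<Gamma>"
  shows "\<exists>a \<in> ind \<Gamma> \<rightarrow>\<^sub>E UNIV. (\<Sum>\<nu>\<in>ind \<Gamma>. a \<nu> * \<nu>) = \<gamma>"
  using assms(1,3)
proof (induction rule: ind_induct)
  case (ind \<mu>)
  have "finite (ind \<Gamma>)"
    using assms(2) ind_subset by (rule rev_finite_subset)
  then have "(\<Sum>\<nu>\<in>ind \<Gamma>. (\<lambda>\<nu>\<in>ind \<Gamma>. of_bool (\<nu> = \<mu>)) \<nu> * \<nu>) = \<mu>"
    using ind by (simp add: of_bool_def if_distrib[of "\<lambda>x. x * _"] cong: if_cong)
  then show ?case
    by (intro bexI[of _ "\<lambda>\<nu>\<in>ind \<Gamma>. of_bool (\<nu> = \<mu>)"]) auto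
next
  case (add a b)
  then obtain c d where "(\<Sum>\<nu>\<in>ind \<Gamma>. c \<nu> * \<nu>) = a" "(\<Sum>\<nu>\<in>ind \<Gamma>. d \<nu> * \<nu>) = b"
    by blast
  then have "(\<Sum>\<nu>\<in>ind \<Gamma>. (\<lambda>\<nu>\<in>ind \<Gamma>. c \<nu> + d \<nu>) \<nu> * \<nu>) = a + b"
    by (simp add: algebra_simps sum.distrib)
  then show ?case
    by (intro bexI[of _ "\<lambda>\<nu>\<in>ind \<Gamma>. c \<nu> + d \<nu>"]) auto
qed

lemma coords_surj:
  fixes x :: "nat \<times> nat \<Rightarrow> 'k::field"
  assumes \<Gamma>: "\<Gamma> \<in> SS m" and "m \<ge> 2" and dec2: "dec_ge2 \<Gamma> = {}"
    and x: "x \<in> affine_space (coord_index m \<Gamma>)"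
  shows "x \<in> coords m \<Gamma> ` AAG m \<Gamma>"
proof -
  let ?I = "ind \<Gamma>"
  have \<Gamma>0: "0 \<notin> \<Gamma>"
    using SS_D(1)[OF \<Gamma>] by auto
  have finI: "finite ?I"
    using SS_D(3)[OF \<Gamma>] ind_subset by (rule rev_finite_subset)
  obtain a where a: "\<And>\<gamma>. \<gamma> \<in> \<Gamma> \<Longrightarrow> (\<Sum>\<nu>\<in>?I. a \<gamma> \<nu> * \<nu>) = \<gamma>"
    using ind_combination_exists[OF \<Gamma>0 SS_D(3)[OF \<Gamma>]] by metis
  \<comment> \<open>The point \<open>x\<close> supplies the coefficients of the prospective
    canonical basis elements.\<close>
  define f where "f \<nu> = monom 1 \<nu> + (\<Sum>\<delta>\<in>CG m \<Gamma> \<nu>. monom (x (\<nu>, \<delta>)) \<delta>)" for \<nu>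
  have f: "canonical_form m \<Gamma> \<nu> (f \<nu>)" for \<nu>
    unfolding f_def canonical_form_iff by (intro exI) (rule refl)
  \<comment> \<open>\<open>dec_ge2 \<Gamma> = {}\<close> yields uniqueness only at decomposable elements, so on \<open>ind \<Gamma>\<close> the exponent
    vectors are prescribed to ensure \<open>g \<nu> = f \<nu>\<close>.\<close>
  define e where "e \<gamma> = (if \<gamma> = 0 then (\<lambda>_. 0) else if \<gamma> \<in> ?I then (\<lambda>\<nu>. of_bool (\<nu> = \<gamma>)) else a \<gamma>)"
    for \<gamma> :: nat
  define g where "g \<gamma> = (\<Prod>\<nu>\<in>?I. f \<nu> ^ e \<gamma> \<nu>)" for \<gamma>
  have e: "(\<Sum>\<nu>\<in>?I. e \<gamma> \<nu> * \<nu>) = \<gamma>" if "\<gamma> \<in> \<Gamma>" for \<gamma>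
    using a[OF that] \<Gamma>0 that finI
    by (auto simp: e_def of_bool_def if_distrib[of "\<lambda>x. x * _"] cong: if_cong)
  have g_lead: "leads \<gamma> (g \<gamma>)" if "\<gamma> \<in> \<Gamma>" for \<gamma>
    using leads_prod_power[OF finI, of f "e \<gamma>"] f canonical_form_leads e[OF that]
    unfolding g_def by metis
  have g_ind: "g \<nu> = f \<nu>" if "\<nu> \<in> ?I" for \<nu>
  proof -
    have "\<nu> \<noteq> 0"
      using that \<Gamma>0 ind_subset by (metis subsetD)
    then have "g \<nu> = (\<Prod>\<mu>\<in>?I. if \<mu> = \<nu> then f \<nu> else 1)"
      unfolding g_def e_def using that by (intro prod.cong) auto
    then show ?thesis
      using that finI by simp
  qed
  have g_mult: "g \<alpha> * g \<beta> = g (\<alpha> + \<beta>)" if "\<alpha> \<in> \<Gamma>" "\<beta> \<in> \<Gamma>" "\<alpha> + \<beta> \<in> \<Gamma>" for \<alpha> \<beta>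
  proof -
    \<comment> \<open>Both vectors represent \<open>\<alpha> + \<beta>\<close>; restriction to
      \<open>?I\<close> places them in the extensional function space over which
      \<open>dec_ge2\<close> quantifies.\<close>
    define u where "u = (\<lambda>\<nu>\<in>?I. e \<alpha> \<nu> + e \<beta> \<nu>)"
    define v where "v = (\<lambda>\<nu>\<in>?I. e (\<alpha> + \<beta>) \<nu>)"
    have "u \<in> ?I \<rightarrow>\<^sub>E UNIV" "v \<in> ?I \<rightarrow>\<^sub>E UNIV"
      by (auto simp: u_def v_def)
    moreover have "(\<Sum>\<nu>\<in>?I. u \<nu> * \<nu>) = \<alpha> + \<beta>" "(\<Sum>\<nu>\<in>?I. v \<nu> * \<nu>) = \<alpha> + \<beta>"
      using e that by (simp_all add: u_def v_def distrib_right sum.distrib)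
    moreover have "\<alpha> + \<beta> \<in> dec \<Gamma>"
      using that by (auto simp: dec_def)
    ultimately have "u = v"
      using dec2 unfolding dec_ge2_def by blast
    have "e \<alpha> \<nu> + e \<beta> \<nu> = e (\<alpha> + \<beta>) \<nu>" if "\<nu> \<in> ?I" for \<nu>
    proof -
      have "u \<nu> = v \<nu>"
        by (simp only: \<open>u = v\<close>)
      then show ?thesis
        by (simp add: u_def v_def that)
    qed
    then show ?thesis
      unfolding g_def by (simp flip: prod.distrib power_add)
  qed
  let ?A = "truncated_span m (insert 0 \<Gamma>) g"
  \<comment> \<open>The premise left open by the underscore is \<open>g 0 = 1\<close>, which holds
    because \<open>e 0\<close> is the zero vector.\<close>
  have A: "?A \<in> AAG m \<Gamma>"
    using \<Gamma> \<open>m \<ge> 2\<close> _ g_lead g_mult by (rule truncated_span_AAG) (auto simp: g_def e_def)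
  have basis: "canonical_basis m ?A \<nu> = f \<nu>" if "\<nu> \<in> ?I" for \<nu>
  proof (rule canonical_basis_eq)
    have \<nu>: "\<nu> \<in> \<Gamma>"
      using that ind_subset by blast
    show "f \<nu> \<in> ?A"
      using truncated_span_base[of "insert 0 \<Gamma>" \<nu> g m] SS_D(3)[OF \<Gamma>] g_ind[OF that] \<nu> by simp
    show "\<nu> \<in> Gam m ?A" "canonical_form m (Gam m ?A) \<nu> (f \<nu>)"
      using A \<nu> f by (auto simp: AAG_def)
  qed (use A \<open>m \<ge> 2\<close> in \<open>auto simp: AAG_def\<close>)
  have "coords m \<Gamma> ?A = x"
  proof (rule extensionalityI[where A = "coord_index m \<Gamma>"])
    show "x \<in> extensional (coord_index m \<Gamma>)"
      using x by (auto simp: affine_space_def PiE_def)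
    show "coords m \<Gamma> ?A i = x i" if i_mem: "i \<in> coord_index m \<Gamma>" for i
    proof -
      obtain \<nu> j where i: "i = (\<nu>, j)" "\<nu> \<in> ?I" "j \<in> CG m \<Gamma> \<nu>"
        using i_mem by (auto simp: coord_index_def)
      then have "coeff (f \<nu>) j = x (\<nu>, j)"
        unfolding f_def coeff_canonical_sum by (auto simp: CG_def)
      then show ?thesis
        using i_mem i basis by (simp add: coords_def)
    qed
  qed (simp add: coords_def)
  with A show ?thesis by blast
qed

lemma coords_image:
  assumes "\<Gamma> \<in> SS m" "m \<ge> 2" "dec_ge2 \<Gamma> = {}"
  shows "coords m \<Gamma> ` (AAG m \<Gamma> :: 'k::field poly set set) = affine_space (coord_index m \<Gamma>)"
  using coords_surj[OF assms] by (auto simp: affine_space_def coords_def)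

section \<open>Passage to standard affine space\<close>

lemma algebraic_set_affine_space: "algebraic_set I (affine_space I)"
  unfolding algebraic_set_def by (rule exI[of _ "{}"]) auto

text \<open>After a numbering \<open>h\<close> of \<open>I\<close>, both maps merely relabel
  coordinates, so each of their components is a coordinate function and hence polynomial.\<close>

lemma isomorphic_affine_space:
  fixes c :: "'a \<Rightarrow> 'i \<Rightarrow> 'k::field"
  assumes fin: "finite I" and inj: "inj_on c X" and img: "c ` X = affine_space I"
  shows "isomorphic_varieties I c X {..<card I} id (affine_space {..<card I})"
proof -
  let ?N = "{..<card I}"
  obtain h where h: "bij_betw h ?N I"
    using ex_bij_betw_nat_finite[OF fin] by (auto simp: atLeast0LessThan)
  define h' where "h' = inv_into ?N h"
  have h'h: "h' (h j) = j" "h j \<in> I" if "j \<in> ?N" for j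
    using h that unfolding h'_def bij_betw_def by auto
  have hh': "h (h' i) = i" "h' i \<in> ?N" if "i \<in> I" for i
    using bij_betw_inv_into_right[OF h that] bij_betw_apply[OF bij_betw_inv_into[OF h] that]
    by (auto simp: h'_def)
  define \<phi> where "\<phi> x = (\<lambda>j\<in>?N. c x (h j))" for x
  define r where "r y = (\<lambda>i\<in>I. y (h' i))" for y :: "nat \<Rightarrow> 'k"
  \<comment> \<open>A preimage of \<open>r y\<close> exists because \<open>c\<close> maps
    \<open>X\<close> onto the affine space; injectivity of \<open>c\<close> later makes \<psi>
    inverse to \<phi>.\<close>
  define \<psi> where "\<psi> y = inv_into X c (r y)" for y
  have r: "r y \<in> c ` X" for y
    unfolding img affine_space_def r_def by auto
  have \<psi>: "\<psi> y \<in> X" "c (\<psi> y) = r y" for y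
    unfolding \<psi>_def using inv_into_into[OF r] f_inv_into_f[OF r] by auto
  have "regular_map I c X ?N id (affine_space ?N) \<phi>"
    unfolding regular_map_def
  proof (intro conjI ballI)
    show "\<phi> \<in> X \<rightarrow> affine_space ?N"
      by (auto simp: \<phi>_def affine_space_def)
    show "\<exists>p. polynomial_fun I p \<and> (\<forall>x\<in>X. id (\<phi> x) j = p (c x))" if "j \<in> ?N" for j
      using that h'h(2) by (intro exI[of _ "\<lambda>x. x (h j)"]) (auto simp: \<phi>_def intro: polynomial_fun.coordinate)
  qed
  moreover have "regular_map ?N id (affine_space ?N) I c X \<psi>"
    unfolding regular_map_def
  proof (intro conjI ballI)
    show "\<psi> \<in> affine_space ?N \<rightarrow> X"
      using \<psi> by auto
    show "\<exists>p. polynomial_fun ?N p \<and> (\<forall>x\<in>affine_space ?N. c (\<psi> x) i = p (id x))" if "i \<in> I" for i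
      using that hh'(2)[OF that] \<psi>
      by (intro exI[of _ "\<lambda>x. x (h' i)"]) (auto simp: r_def intro: polynomial_fun.coordinate)
  qed
  moreover have "\<psi> (\<phi> x) = x" if "x \<in> X" for x
  proof -
    have "c x \<in> extensional I"
      using that img by (auto simp: affine_space_def PiE_def)
    then have "r (\<phi> x) = c x"
      using hh' by (intro extensionalityI[where A = I]) (auto simp: r_def \<phi>_def)
    then show ?thesis
      using inj that \<psi> by (metis inj_onD)
  qed
  moreover have "\<phi> (\<psi> y) = y" if "y \<in> affine_space ?N" for y
    using that h'h \<psi>
    by (intro extensionalityI[where A = ?N]) (auto simp: affine_space_def PiE_def \<phi>_def r_def)
  ultimately show ?thesis
    unfolding isomorphic_varieties_def affine_variety_def
    using fin inj img by (auto simp: algebraic_set_affine_space)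
qed

text \<open>Common source of both claims. The coordinates are indexed by a \<open>SIGMA\<close>, so
  their number is the sum of the numbers of gaps above the indecomposable elements.\<close>

lemma AAG_isomorphic_affine_space:
  assumes "\<Gamma> \<in> SS m" "m \<ge> 2" "dec_ge2 \<Gamma> = {}"
  shows "isomorphic_varieties (coord_index m \<Gamma>) (coords m \<Gamma>) (AAG m \<Gamma> :: 'k::field poly set set)
    {..<\<Sum>\<nu>\<in>ind \<Gamma>. card (CG m \<Gamma> \<nu>)} id (affine_space {..<\<Sum>\<nu>\<in>ind \<Gamma>. card (CG m \<Gamma> \<nu>)})"
proof -
  have fin: "finite (ind \<Gamma>)"
    using SS_D(3)[OF assms(1)] ind_subset by (rule rev_finite_subset)
  have "0 \<notin> \<Gamma>"
    using SS_D(1)[OF assms(1)] by auto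
  then have inj: "inj_on (coords m \<Gamma>) (AAG m \<Gamma> :: 'k poly set set)"
    using assms(2) by (intro coords_inj) auto
  have "finite (coord_index m \<Gamma>)" "card (coord_index m \<Gamma>) = (\<Sum>\<nu>\<in>ind \<Gamma>. card (CG m \<Gamma> \<nu>))"
    using fin finite_CG by (auto simp: coord_index_def)
  with isomorphic_affine_space[OF _ inj coords_image[OF assms]] show ?thesis
    by simp
qed

text \<open>With a single generator \<open>\<nu> \<noteq> 0\<close>, the equation
  \<open>a \<nu> * \<nu> = \<gamma>\<close> determines \<open>a \<nu>\<close>, and with it the
  extensional vector on \<open>{\<nu>}\<close>.\<close>

lemma dec_ge2_empty_if_ind_singleton:
  assumes ind: "ind \<Gamma> = {\<nu>}" and "0 \<notin> \<Gamma>"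
  shows "dec_ge2 \<Gamma> = {}"
proof -
  have "\<nu> \<in> \<Gamma>"
    using ind ind_subset[of \<Gamma>] by simp
  then have "\<nu> \<noteq> 0"
    using assms(2) by metis
  have "a = b" if ab: "a \<in> {\<nu>} \<rightarrow>\<^sub>E UNIV" "b \<in> {\<nu>} \<rightarrow>\<^sub>E UNIV"
    and eq: "(\<Sum>\<mu>\<in>{\<nu>}. a \<mu> * \<mu>) = \<gamma>" "(\<Sum>\<mu>\<in>{\<nu>}. b \<mu> * \<mu>) = \<gamma>" for a b :: "nat \<Rightarrow> nat" and \<gamma>
  proof (rule PiE_ext[OF ab])
    have "a \<nu> * \<nu> = b \<nu> * \<nu>"
      using eq by simp
    then show "a \<mu> = b \<mu>" if "\<mu> \<in> {\<nu>}" for \<mu>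
      using that \<open>\<nu> \<noteq> 0\<close> by simp
  qed
  then show ?thesis
    unfolding dec_ge2_def ind by blast
qed

theorem lemma4p1:
  fixes m :: nat and \<Gamma> :: "nat set"
  assumes "m \<ge> 4" and "\<Gamma> \<in> SS m"
  shows "(\<forall>\<nu>. ind \<Gamma> = {\<nu>} \<longrightarrow>
            isomorphic_varieties
              (coord_index m \<Gamma>) (coords m \<Gamma>) (AAG m \<Gamma> :: 'k::field poly set set)
              {..<card (CG m \<Gamma> \<nu>)} id (affine_space {..<card (CG m \<Gamma> \<nu>)})) \<and>
         (card (ind \<Gamma>) \<ge> 2 \<and> dec_ge2 \<Gamma> = {} \<longrightarrow>
            isomorphic_varieties
              (coord_index m \<Gamma>) (coords m \<Gamma>) (AAG m \<Gamma> :: 'k poly set set)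
              {..<\<Sum>\<nu>\<in>ind \<Gamma>. card (CG m \<Gamma> \<nu>)} id
              (affine_space {..<\<Sum>\<nu>\<in>ind \<Gamma>. card (CG m \<Gamma> \<nu>)}))"
proof (intro conjI allI impI)
  fix \<nu> assume \<nu>: "ind \<Gamma> = {\<nu>}"
  have "0 \<notin> \<Gamma>"
    using SS_D(1)[OF assms(2)] by auto
  then have "dec_ge2 \<Gamma> = {}"
    by (rule dec_ge2_empty_if_ind_singleton[OF \<nu>])
  \<comment> \<open>The sum over \<open>ind \<Gamma>\<close> collapses to its single term.\<close>
  with AAG_isomorphic_affine_space[OF assms(2)] \<nu> assms(1)
  show "isomorphic_varieties
      (coord_index m \<Gamma>) (coords m \<Gamma>) (AAG m \<Gamma> :: 'k poly set set)
      {..<card (CG m \<Gamma> \<nu>)} id (affine_space {..<card (CG m \<Gamma> \<nu>)})"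
    by simp
next
  assume "card (ind \<Gamma>) \<ge> 2 \<and> dec_ge2 \<Gamma> = {}"
  with AAG_isomorphic_affine_space[OF assms(2)] assms(1)
  show "isomorphic_varieties
      (coord_index m \<Gamma>) (coords m \<Gamma>) (AAG m \<Gamma> :: 'k poly set set)
      {..<\<Sum>\<nu>\<in>ind \<Gamma>. card (CG m \<Gamma> \<nu>)} id
      (affine_space {..<\<Sum>\<nu>\<in>ind \<Gamma>. card (CG m \<Gamma> \<nu>)})"
    by simp
qed

end
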